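(* Let $G$ be a finite simple graph of order $n$. Then $\alpha_1'(G) \le \left\lfloor \frac{n+1}{2} \right\rfloor$, with equality if and only if $G$ is a faithful graph.
   Context: All graphs are finite, simple and undirected. For a graph $G$, a $1$-nearly edge independent set of $G$ is a set $M \subseteq E(G)$ such that $M$ contains exactly one (unordered) pair of distinct edges that are adjacent in $G$ (i.e. share a common end vertex). The $1$-nearly edge independence number $\alpha_1'(G)$ is the maximum cardinality of a $1$-nearly edge independent set of $G$, taken to be $0$ if $G$ has no such set. A graph $G$ of order $n$ is called faithful if $G$ has a spanning subgraph $F$ (a subgraph with vertex set $V(G)$) that is a forest isomorphic to $P_3 \cup \frac{n-3}{2}K_2$ if $n$ is odd, and to $P_3 \cup \frac{n-4}{2}K_2 \cup K_1$ if $n$ is even. Here $P_3$ is the path on $3$ vertices, $K_m$ the complete graph on $m$ vertices, $tH$ the disjoint union of $t$ copies of $H$, and $\cup$ disjoint union. *)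

theory Defs
  imports Main "HOL-Library.Ramsey"
begin

record 'a graph =
  verts :: "'a set"
  edges :: "'a set set"

definition finite_simple_graph :: "'a graph \<Rightarrow> bool" where
  "finite_simple_graph G \<longleftrightarrow> finite (verts G) \<and> edges G \<subseteq> [verts G]\<^bsup>2\<^esup>"

definition spanning_subgraph :: "'a graph \<Rightarrow> 'a graph \<Rightarrow> bool" where
  "spanning_subgraph F G \<longleftrightarrow>
     finite_simple_graph F \<and> verts F = verts G \<and> edges F \<subseteq> edges G"

definition graph_isomorphic :: "'a graph \<Rightarrow> 'b graph \<Rightarrow> bool" where
  "graph_isomorphic G H \<longleftrightarrow>
     (\<exists>f. bij_betw f (verts G) (verts H) \<and>
          (\<forall>u\<in>verts G. \<forall>v\<in>verts G. {u, v} \<in> edges G \<longleftrightarrow> {f u, f v} \<in> edges H))"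

definition path_graph :: "nat \<Rightarrow> nat graph" where
  "path_graph m = \<lparr>verts = {..<m}, edges = {{i, Suc i} | i. Suc i < m}\<rparr>"

definition complete_graph :: "nat \<Rightarrow> nat graph" where
  "complete_graph m = \<lparr>verts = {..<m}, edges = [{..<m}]\<^bsup>2\<^esup>\<rparr>"

definition disjoint_union_graph :: "'a graph \<Rightarrow> 'b graph \<Rightarrow> ('a + 'b) graph" where
  "disjoint_union_graph G H =
     \<lparr>verts = verts G <+> verts H,
      edges = (`) Inl ` edges G \<union> (`) Inr ` edges H\<rparr>"

definition copies_graph :: "nat \<Rightarrow> 'a graph \<Rightarrow> (nat \<times> 'a) graph" where
  "copies_graph t H =
     \<lparr>verts = {..<t} \<times> verts H,
      edges = {Pair i ` e | i e. i < t \<and> e \<in> edges H}\<rparr>"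

definition adjacent_pairs :: "'a set set \<Rightarrow> 'a set set set" where
  "adjacent_pairs M = {{e, f} | e f. e \<in> M \<and> f \<in> M \<and> e \<noteq> f \<and> e \<inter> f \<noteq> {}}"

definition one_nearly_edge_independent :: "'a graph \<Rightarrow> 'a set set \<Rightarrow> bool" where
  "one_nearly_edge_independent G M \<longleftrightarrow> M \<subseteq> edges G \<and> card (adjacent_pairs M) = 1"

definition one_nearly_edge_independence_number :: "'a graph \<Rightarrow> nat" where
  "one_nearly_edge_independence_number G =
     (if \<exists>M. one_nearly_edge_independent G M
      then Max (card ` {M. one_nearly_edge_independent G M}) else 0)"

text \<open>
  For orders 0, 1 and 2 the natural-number subtraction below truncates to 0 copies
  of the complete graph on two vertices. No such graph becomes faithful by this: the required
  forest then has three or four vertices, more than a spanning subgraph can have.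
\<close>
definition faithful :: "'a graph \<Rightarrow> bool" where
  "faithful G \<longleftrightarrow>
     (let n = card (verts G) in
      \<exists>F. spanning_subgraph F G \<and>
        (if odd n
         then graph_isomorphic F
                (disjoint_union_graph (path_graph 3)
                   (copies_graph ((n - 3) div 2) (complete_graph 2)))
         else graph_isomorphic F
                (disjoint_union_graph
                   (disjoint_union_graph (path_graph 3)
                      (copies_graph ((n - 4) div 2) (complete_graph 2)))
                   (complete_graph 1))))"

end

theory Submission
  imports Defs
begin

text \<open>
  A set of edges with exactly one adjacent pair consists of a path with two edges and a matching
  that avoids it. If it has m edges it therefore covers exactly 2m - 1 vertices, whence
  m is at most (n + 1) div 2. In the case of equality at most one vertex remains uncovered, and the
  edge set with all vertices of the graph is the forest required for faithfulness.
  Conversely the edge set of that forest has a single adjacent pair and (n + 1) div 2 elements.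
\<close>

section \<open>Isomorphisms as vertex bijections that transport edge sets\<close>

text \<open>This is isomorphism with the edge condition stated as an equality of edge sets rather
  than adjacency of pairs of vertices. In this form maps on the components of a disjoint union can
  be glued, and edge counts and adjacent pairs transfer as images. The map goes from the model
  \<open>H\<close> to the graph \<open>F\<close>.\<close>

definition carries_onto :: "('b \<Rightarrow> 'a) \<Rightarrow> 'b graph \<Rightarrow> 'a graph \<Rightarrow> bool" where
  "carries_onto g H F \<longleftrightarrow> bij_betw g (verts H) (verts F) \<and> edges F = (`) g ` edges H"

lemma finite_simple_graphD:
  assumes "finite_simple_graph G" "e \<in> edges G"
  shows "e \<subseteq> verts G" "card e = 2" "finite e" "\<exists>u v. u \<noteq> v \<and> e = {u, v}"
proof -
  show e: "e \<subseteq> verts G" "card e = 2" "finite e"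
    using assms by (auto simp: finite_simple_graph_def nsets_def)
  show "\<exists>u v. u \<noteq> v \<and> e = {u, v}" using e(2) by (auto simp: card_2_iff)
qed

text \<open>The inverse of \<open>g\<close> is the isomorphism. As \<open>g\<close> is injective on
  the vertices, distinct vertex sets have distinct images, so an edge of \<open>F\<close> comes from
  exactly one vertex pair of \<open>H\<close>.\<close>

lemma graph_isomorphic_if_carries_onto:
  assumes H: "finite_simple_graph H" and g: "carries_onto g H F"
  shows "graph_isomorphic F H"
proof -
  let ?f = "the_inv_into (verts H) g"
  have bij: "bij_betw g (verts H) (verts F)" and E: "edges F = (`) g ` edges H"
    using g by (auto simp: carries_onto_def)
  have inj: "inj_on g (verts H)" and im: "g ` verts H = verts F"
    using bij by (auto simp: bij_betw_def)
  have "{g x, g y} \<in> edges F \<longleftrightarrow> {x, y} \<in> edges H" if "x \<in> verts H" "y \<in> verts H" for x y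
  proof
    assume "{g x, g y} \<in> edges F"
    then obtain e where e: "e \<in> edges H" "g ` {x, y} = g ` e" using E by auto
    then have "{x, y} = e"
      using inj_on_image_eq_iff[OF inj, of "{x, y}" e] that finite_simple_graphD(1)[OF H] by auto
    then show "{x, y} \<in> edges H" using e by simp
  next
    assume "{x, y} \<in> edges H"
    then have "g ` {x, y} \<in> edges F" using E by blast
    then show "{g x, g y} \<in> edges F" by simp
  qed
  then have "\<forall>u\<in>verts F. \<forall>v\<in>verts F. {u, v} \<in> edges F \<longleftrightarrow> {?f u, ?f v} \<in> edges H"
    unfolding im[symmetric] using inj by (simp add: the_inv_into_f_f)
  then show ?thesis
    unfolding graph_isomorphic_def using bij_betw_the_inv_into[OF bij] by blast
qed

text \<open>\<open>graph_isomorphic\<close> only constrains sets of the form \<open>{u, v}\<close>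
  with \<open>u\<close> and \<open>v\<close> vertices. Simplicity of both graphs makes every edge
  such a set, so the adjacency condition determines the whole edge set.\<close>

lemma carries_onto_if_graph_isomorphic:
  assumes H: "finite_simple_graph H" and F: "finite_simple_graph F"
    and iso: "graph_isomorphic F H"
  shows "\<exists>g. carries_onto g H F"
proof -
  obtain f where bij: "bij_betw f (verts F) (verts H)"
    and adj: "\<And>u v. u \<in> verts F \<Longrightarrow> v \<in> verts F \<Longrightarrow> {u, v} \<in> edges F \<longleftrightarrow> {f u, f v} \<in> edges H"
    using iso unfolding graph_isomorphic_def by blast
  define g where "g = the_inv_into (verts F) f"
  have inj: "inj_on f (verts F)" and im: "f ` verts F = verts H"
    using bij by (auto simp: bij_betw_def)
  have gf: "g (f u) = u" if "u \<in> verts F" for u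
    using that inj by (simp add: g_def the_inv_into_f_f)
  have "e \<in> (`) g ` edges H" if e: "e \<in> edges F" for e
  proof -
    obtain u v where uv: "e = {u, v}" "u \<in> verts F" "v \<in> verts F"
      using finite_simple_graphD[OF F e] by auto
    then have "{f u, f v} \<in> edges H" using adj e by blast
    moreover have "e = g ` {f u, f v}" using uv gf by simp
    ultimately show ?thesis by blast
  qed
  moreover have "g ` e \<in> edges F" if e: "e \<in> edges H" for e
  proof -
    obtain x y where xy: "e = {x, y}" "x \<in> verts H" "y \<in> verts H"
      using finite_simple_graphD[OF H e] by auto
    then obtain u v where "x = f u" "y = f v" "u \<in> verts F" "v \<in> verts F"
      using im by blast
    then show ?thesis using adj e xy gf by simp
  qed
  ultimately have "edges F = (`) g ` edges H" by blast
  then show ?thesis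
    unfolding carries_onto_def g_def using bij_betw_the_inv_into[OF bij] by blast
qed

section \<open>The components of the forests are simple graphs\<close>

lemma finite_simple_graph_path: "finite_simple_graph (path_graph m)"
  by (auto simp: finite_simple_graph_def path_graph_def nsets_def)

lemma finite_simple_graph_complete: "finite_simple_graph (complete_graph m)"
  by (auto simp: finite_simple_graph_def complete_graph_def)

lemma finite_simple_graph_copies:
  assumes "finite_simple_graph H"
  shows "finite_simple_graph (copies_graph t H)"
proof -
  have "Pair i ` e \<in> [{..<t} \<times> verts H]\<^bsup>2\<^esup>" if "i < t" "e \<in> edges H" for i e
    using that finite_simple_graphD(1-3)[OF assms that(2)]
    by (auto simp: nsets_def card_image inj_on_def)
  then show ?thesis
    using assms by (auto simp: finite_simple_graph_def copies_graph_def)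
qed

lemma finite_simple_graph_disjoint_union:
  assumes "finite_simple_graph G" "finite_simple_graph H"
  shows "finite_simple_graph (disjoint_union_graph G H)"
proof -
  have "Inl ` e \<in> [verts G <+> verts H]\<^bsup>2\<^esup>" if "e \<in> edges G" for e
    using finite_simple_graphD(1-3)[OF assms(1) that] by (auto simp: nsets_def card_image)
  moreover have "Inr ` e \<in> [verts G <+> verts H]\<^bsup>2\<^esup>" if "e \<in> edges H" for e
    using finite_simple_graphD(1-3)[OF assms(2) that] by (auto simp: nsets_def card_image)
  ultimately show ?thesis
    using assms by (auto simp: finite_simple_graph_def disjoint_union_graph_def)
qed

section \<open>Realising the forests on given vertices\<close>

text \<open>Allows the forest to be assembled one component at a time; \<open>A\<close> and
  \<open>B\<close> being disjoint is what keeps the combined map injective across the two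
  summands.\<close>

lemma carries_onto_disjoint_union:
  assumes g: "carries_onto g G \<lparr>verts = A, edges = M\<rparr>"
    and h: "carries_onto h H \<lparr>verts = B, edges = N\<rparr>"
    and "A \<inter> B = {}"
  shows "carries_onto (case_sum g h) (disjoint_union_graph G H)
           \<lparr>verts = A \<union> B, edges = M \<union> N\<rparr>"
proof -
  have "bij_betw (case_sum g h) (verts G <+> verts H) (A \<union> B)"
  proof -
    have "inj_on g (verts G)" "g ` verts G = A" "inj_on h (verts H)" "h ` verts H = B"
      using g h by (auto simp: carries_onto_def bij_betw_def)
    moreover have "inj_on (case_sum g h) (verts G <+> verts H)"
    proof (rule inj_onI)
      fix x y
      assume "x \<in> verts G <+> verts H" "y \<in> verts G <+> verts H"
        "case_sum g h x = case_sum g h y"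
      then show "x = y"
        using calculation assms(3) by (cases x; cases y) (auto dest: inj_onD)
    qed
    ultimately show ?thesis
      by (simp add: bij_betw_def Plus_def image_Un image_image)
  qed
  then show ?thesis
    using g h by (simp add: carries_onto_def disjoint_union_graph_def image_Un image_image)
qed

lemma edges_path_graph_3: "edges (path_graph 3) = {{0, 1}, {1, 2}}"
proof -
  have "{{i, Suc i} | i. Suc i < 3} = (\<lambda>i. {i, Suc i}) ` {..<2}" by auto
  also have "\<dots> = {{0, 1}, {1, 2}}" by (auto simp: numeral_2_eq_2 lessThan_Suc)
  finally show ?thesis by (simp add: path_graph_def)
qed

lemma edges_complete_graph_2: "edges (complete_graph 2) = {{..<2}}"
proof -
  have "e = {..<2::nat}" if "e \<subseteq> {..<2}" "card e = 2" for e
    using card_subset_eq[of "{..<2::nat}" e] that by simp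
  then show ?thesis by (auto simp: complete_graph_def nsets_def)
qed

lemma edges_complete_graph_1: "edges (complete_graph 1) = {}"
proof -
  have "card e \<noteq> 2" if "e \<subseteq> {..<1::nat}" for e
    using card_mono[OF _ that] by simp
  then show ?thesis unfolding complete_graph_def nsets_def by simp
qed

lemma edges_copies_complete_graph_2:
  "edges (copies_graph t (complete_graph 2)) = (\<lambda>i. {i} \<times> {..<2}) ` {..<t}"
  by (auto simp: copies_graph_def edges_complete_graph_2)

lemma carries_onto_path_graph_3:
  assumes "distinct [a, b, c]"
  shows "\<exists>g. carries_onto g (path_graph 3) \<lparr>verts = {a, b, c}, edges = {{a, b}, {b, c}}\<rparr>"
proof
  let ?g = "\<lambda>i::nat. if i = 0 then a else if i = 1 then b else c"
  have "{..<3::nat} = {0, 1, 2}" by auto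
  then show "carries_onto ?g (path_graph 3) \<lparr>verts = {a, b, c}, edges = {{a, b}, {b, c}}\<rparr>"
    using assms
    by (simp add: carries_onto_def edges_path_graph_3 bij_betw_def insert_commute)
       (simp add: path_graph_def insert_commute)
qed

lemma carries_onto_complete_graph_1:
  "carries_onto (\<lambda>_. v) (complete_graph 1) \<lparr>verts = {v}, edges = {}\<rparr>"
  unfolding carries_onto_def edges_complete_graph_1
  by (auto simp: bij_betw_def complete_graph_def inj_on_def)

text \<open>Enumerate the edges by \<open>h\<close> and the two ends of the edge \<open>h i\<close>
  by \<open>k i\<close>; then \<open>(i, j)\<close> goes to end \<open>j\<close> of edge
  \<open>i\<close>. Pairwise disjointness of the edges makes this injective.\<close>

lemma carries_onto_matching:
  assumes fin: "finite N" and card2: "\<And>e. e \<in> N \<Longrightarrow> card e = 2"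
    and dis: "\<And>e f. e \<in> N \<Longrightarrow> f \<in> N \<Longrightarrow> e \<noteq> f \<Longrightarrow> e \<inter> f = {}"
  shows "\<exists>g. carries_onto g (copies_graph (card N) (complete_graph 2))
               \<lparr>verts = \<Union>N, edges = N\<rparr>"
proof -
  obtain h where h: "bij_betw h {..<card N} N"
    using ex_bij_betw_nat_finite[OF fin] by (auto simp: atLeast0LessThan)
  have hN: "h i \<in> N" if "i < card N" for i
    using h that by (auto simp: bij_betw_def)
  have "\<exists>k. bij_betw k {..<2::nat} (h i)" if "i < card N" for i
  proof -
    have "card (h i) = 2" using card2 hN that by blast
    moreover from this have "finite (h i)" using card.infinite by fastforce
    ultimately show ?thesis using ex_bij_betw_nat_finite[of "h i"] by (simp add: atLeast0LessThan)
  qed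
  then obtain k where k: "\<And>i. i < card N \<Longrightarrow> bij_betw (k i) {..<2::nat} (h i)"
    by metis
  let ?g = "\<lambda>(i, j). k i j"
  have row: "?g ` ({i} \<times> {..<2}) = h i" if "i < card N" for i
    using k[OF that] by (force simp: bij_betw_def)
  have N: "N = h ` {..<card N}" using h by (auto simp: bij_betw_def)
  have "(`) ?g ` (\<lambda>i. {i} \<times> {..<2}) ` {..<card N} = N"
    using row by (subst (2) N) (auto simp: image_image)
  moreover have "?g ` ({..<card N} \<times> {..<2}) = \<Union>N"
  proof -
    have "{..<card N} \<times> {..<2::nat} = (\<Union>i<card N. {i} \<times> {..<2})" by auto
    then have "?g ` ({..<card N} \<times> {..<2}) = (\<Union>i<card N. ?g ` ({i} \<times> {..<2}))"
      by (simp only: image_UN)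
    also have "\<dots> = (\<Union>i<card N. h i)" using row by (intro SUP_cong) auto
    also have "\<dots> = \<Union>N" by (subst (2) N) simp
    finally show ?thesis .
  qed
  moreover have "inj_on ?g ({..<card N} \<times> {..<2})"
  proof (rule inj_onI, clarsimp)
    fix i j i' j' :: nat
    assume *: "i < card N" "j < 2" "i' < card N" "j' < 2" "k i j = k i' j'"
    have "k i j \<in> h i" "k i' j' \<in> h i'"
      using bij_betw_apply[OF k] * by blast+
    \<comment> \<open>The common value lies in both edges, and two edges of a matching that meet are
      equal.\<close>
    then have "h i = h i'" using dis[of "h i" "h i'"] hN * by auto
    then have "i = i'" using h * by (auto simp: bij_betw_def inj_on_def)
    then show "i = i' \<and> j = j'" using k[of i] * by (auto simp: bij_betw_def inj_on_def)
  qed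
  ultimately have "carries_onto ?g (copies_graph (card N) (complete_graph 2))
      \<lparr>verts = \<Union>N, edges = N\<rparr>"
    by (simp add: carries_onto_def edges_copies_complete_graph_2 bij_betw_def)
       (simp add: copies_graph_def complete_graph_def)
  then show ?thesis by blast
qed

section \<open>Adjacent pairs under injections and disjoint unions\<close>

lemma adjacent_pairsI:
  "e \<in> M \<Longrightarrow> f \<in> M \<Longrightarrow> e \<noteq> f \<Longrightarrow> e \<inter> f \<noteq> {} \<Longrightarrow> {e, f} \<in> adjacent_pairs M"
  unfolding adjacent_pairs_def by blast

text \<open>Adjacency refers only to whether two edges are equal and whether they meet, and a map
  injective on \<open>V\<close> preserves and reflects both for subsets of \<open>V\<close>.\<close>

lemma adjacent_pairs_image:
  assumes inj: "inj_on g V" and sub: "M \<subseteq> Pow V"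
  shows "adjacent_pairs ((`) g ` M) = (`) ((`) g) ` adjacent_pairs M"
proof -
  have eq: "g ` e = g ` f \<longleftrightarrow> e = f" if "e \<in> M" "f \<in> M" for e f
    using that sub inj_on_image_eq_iff[OF inj, of e f] by blast
  have disj: "g ` e \<inter> g ` f = {} \<longleftrightarrow> e \<inter> f = {}" if "e \<in> M" "f \<in> M" for e f
    using that sub inj_on_image_Int[OF inj, of e f] by (metis PowD image_is_empty subsetD)
  show ?thesis
  proof (intro subset_antisym subsetI)
    fix P assume "P \<in> adjacent_pairs ((`) g ` M)"
    then obtain e f where ef: "e \<in> M" "f \<in> M" "g ` e \<noteq> g ` f" "g ` e \<inter> g ` f \<noteq> {}"
      "P = {g ` e, g ` f}"
      unfolding adjacent_pairs_def by auto
    then have "{e, f} \<in> adjacent_pairs M" "P = (`) g ` {e, f}"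
      using eq disj by (auto intro!: adjacent_pairsI)
    then show "P \<in> (`) ((`) g) ` adjacent_pairs M" by blast
  next
    fix P assume "P \<in> (`) ((`) g) ` adjacent_pairs M"
    then obtain e f where ef: "e \<in> M" "f \<in> M" "e \<noteq> f" "e \<inter> f \<noteq> {}" "P = {g ` e, g ` f}"
      unfolding adjacent_pairs_def by auto
    then show "P \<in> adjacent_pairs ((`) g ` M)"
      using eq disj by (auto intro!: adjacent_pairsI)
  qed
qed

text \<open>An adjacent pair is a set of sets of vertices, so injectivity of \<open>g\<close> has to
  be lifted through two power sets.\<close>

lemma card_adjacent_pairs_image:
  assumes inj: "inj_on g V" and sub: "M \<subseteq> Pow V"
  shows "card (adjacent_pairs ((`) g ` M)) = card (adjacent_pairs M)"
proof -
  have "adjacent_pairs M \<subseteq> Pow (Pow V)"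
    using sub unfolding adjacent_pairs_def by auto
  then have "inj_on ((`) ((`) g)) (adjacent_pairs M)"
    using inj_on_subset inj_on_image_Pow[OF inj_on_image_Pow[OF inj]] by blast
  then show ?thesis
    by (simp add: adjacent_pairs_image[OF assms] card_image)
qed

text \<open>An edge of \<open>M\<close> never meets an edge of \<open>N\<close>, so no adjacent pair
  is mixed.\<close>

lemma adjacent_pairs_Un:
  assumes "\<Union>M \<inter> \<Union>N = {}"
  shows "adjacent_pairs (M \<union> N) = adjacent_pairs M \<union> adjacent_pairs N"
proof (intro subset_antisym subsetI)
  fix P assume "P \<in> adjacent_pairs (M \<union> N)"
  then obtain e f where "e \<in> M \<union> N" "f \<in> M \<union> N" "e \<noteq> f" "e \<inter> f \<noteq> {}" "P = {e, f}"
    unfolding adjacent_pairs_def by blast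
  moreover from this have "e \<in> M \<and> f \<in> M \<or> e \<in> N \<and> f \<in> N" using assms by blast
  ultimately show "P \<in> adjacent_pairs M \<union> adjacent_pairs N"
    by (auto intro: adjacent_pairsI)
qed (auto simp: adjacent_pairs_def)

text \<open>Used to attach the matching and the isolated vertex to the path without creating a
  second adjacent pair.\<close>

lemma card_adjacent_pairs_disjoint_union:
  assumes "adjacent_pairs (edges H) = {}"
  shows "card (adjacent_pairs (edges (disjoint_union_graph G H))) = card (adjacent_pairs (edges G))"
proof -
  have "adjacent_pairs ((`) Inr ` edges H) = {}"
    using adjacent_pairs_image[of Inr UNIV "edges H"] assms by simp
  then have "adjacent_pairs (edges (disjoint_union_graph G H)) = adjacent_pairs ((`) Inl ` edges G)"
    unfolding disjoint_union_graph_def graph.simps by (subst adjacent_pairs_Un) auto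
  then show ?thesis
    using card_adjacent_pairs_image[of Inl UNIV "edges G"] by simp
qed

lemma adjacent_pairs_copies_complete_graph_2:
  "adjacent_pairs (edges (copies_graph t (complete_graph 2))) = {}"
proof -
  have "i = j" if "({i} \<times> {..<2::nat}) \<inter> ({j} \<times> {..<2}) \<noteq> {}" for i j :: nat
    using that by blast
  then show ?thesis unfolding adjacent_pairs_def edges_copies_complete_graph_2 by blast
qed

lemma card_adjacent_pairs_path_graph_3: "card (adjacent_pairs (edges (path_graph 3))) = 1"
proof -
  have pair: "adjacent_pairs {e, f} = {{e, f}}" if "e \<noteq> f" "e \<inter> f \<noteq> {}" for e f :: "nat set"
  proof
    show "adjacent_pairs {e, f} \<subseteq> {{e, f}}" by (auto simp: adjacent_pairs_def)
    show "{{e, f}} \<subseteq> adjacent_pairs {e, f}" using that by (auto intro!: adjacent_pairsI)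
  qed
  have "{0, 1} \<noteq> {1, 2::nat}" by (simp add: doubleton_eq_iff)
  then show ?thesis unfolding edges_path_graph_3 by (subst pair) auto
qed

section \<open>Edge and vertex counts of the forests\<close>

lemma card_edges_disjoint_union:
  assumes "finite (edges G)" "finite (edges H)" "{} \<notin> edges G"
  shows "card (edges (disjoint_union_graph G H)) = card (edges G) + card (edges H)"
proof -
  have "inj ((`) (Inl :: 'a \<Rightarrow> 'a + 'b))" "inj ((`) (Inr :: 'b \<Rightarrow> 'a + 'b))"
    by (auto intro!: injI simp: inj_image_eq_iff)
  \<comment> \<open>The only set that is both an \<open>Inl\<close> image and an \<open>Inr\<close>
    image is the empty one, which is not an edge of \<open>G\<close>.\<close>
  moreover have "(`) Inl ` edges G \<inter> (`) Inr ` edges H = {}"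
  proof -
    have "e = {}" if "Inl ` e = Inr ` f" for e :: "'a set" and f :: "'b set"
      using that by blast
    then show ?thesis using assms(3) by blast
  qed
  ultimately show ?thesis
    using assms(1,2) unfolding disjoint_union_graph_def
    by (simp add: card_Un_disjoint card_image[OF inj_on_subset[OF _ subset_UNIV]])
qed

lemma card_edges_copies_complete_graph_2:
  "card (edges (copies_graph t (complete_graph 2))) = t"
proof -
  have "i = j" if "{i} \<times> {..<2::nat} = {j} \<times> {..<2}" for i j :: nat
    using that by (simp add: times_eq_iff lessThan_empty_iff)
  then have "inj_on (\<lambda>i. {i} \<times> {..<2::nat}) {..<t}"
    by (rule inj_onI)
  then show ?thesis by (simp add: edges_copies_complete_graph_2 card_image)
qed

lemma finite_edges: "finite_simple_graph G \<Longrightarrow> finite (edges G)"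
  unfolding finite_simple_graph_def by (meson finite_imp_finite_nsets finite_subset)

lemma card_verts_path_copies:
  "card (verts (disjoint_union_graph (path_graph 3) (copies_graph t (complete_graph 2)))) = 3 + 2 * t"
  by (simp add: disjoint_union_graph_def path_graph_def copies_graph_def complete_graph_def
      card_Plus card_cartesian_product)

lemma card_edges_path_copies:
  "card (edges (disjoint_union_graph (path_graph 3) (copies_graph t (complete_graph 2)))) = 2 + t"
proof -
  have "card (edges (path_graph 3)) = 2" "{} \<notin> edges (path_graph 3)"
    by (auto simp: edges_path_graph_3 doubleton_eq_iff)
  then show ?thesis
    by (subst card_edges_disjoint_union)
       (auto simp: finite_edges finite_simple_graph_path finite_simple_graph_copies
          finite_simple_graph_complete card_edges_copies_complete_graph_2)
qed

lemma card_adjacent_pairs_path_copies: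
  "card (adjacent_pairs (edges (disjoint_union_graph (path_graph 3)
     (copies_graph t (complete_graph 2))))) = 1"
  by (simp only: card_adjacent_pairs_disjoint_union adjacent_pairs_copies_complete_graph_2
      card_adjacent_pairs_path_graph_3)

lemma finite_simple_graph_path_copies:
  "finite_simple_graph (disjoint_union_graph (path_graph 3) (copies_graph t (complete_graph 2)))"
  by (intro finite_simple_graph_disjoint_union finite_simple_graph_path finite_simple_graph_copies
      finite_simple_graph_complete)

section \<open>From a spanning forest to an edge set of the extremal size\<close>

text \<open>Reduces both parities to counting in the model forest \<open>H\<close>, since its
  adjacent pairs, edges and vertices are all transported injectively.\<close>

lemma one_nearly_edge_independent_if_carries_onto:
  assumes H: "finite_simple_graph H" "card (adjacent_pairs (edges H)) = 1"
    and F: "spanning_subgraph F G" and g: "carries_onto g H F"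
  shows "one_nearly_edge_independent G (edges F)" "card (edges F) = card (edges H)"
    "card (verts G) = card (verts H)"
proof -
  have inj: "inj_on g (verts H)" and E: "edges F = (`) g ` edges H"
    using g by (auto simp: carries_onto_def bij_betw_def)
  have sub: "edges H \<subseteq> Pow (verts H)" using finite_simple_graphD(1)[OF H(1)] by blast
  show "one_nearly_edge_independent G (edges F)"
    using H(2) F card_adjacent_pairs_image[OF inj sub]
    unfolding one_nearly_edge_independent_def spanning_subgraph_def E by simp
  show "card (edges F) = card (edges H)"
    unfolding E using inj_on_subset[OF inj_on_image_Pow[OF inj] sub] by (rule card_image)
  show "card (verts G) = card (verts H)"
    using g F bij_betw_same_card[of g "verts H" "verts F"]
    unfolding carries_onto_def spanning_subgraph_def by simp
qed

lemma one_nearly_edge_independent_if_faithful: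
  assumes "faithful G"
  shows "\<exists>M. one_nearly_edge_independent G M \<and> card M = (card (verts G) + 1) div 2"
proof -
  let ?n = "card (verts G)"
  let ?P = "\<lambda>t. disjoint_union_graph (path_graph 3) (copies_graph t (complete_graph 2))"
  let ?Q = "\<lambda>t. disjoint_union_graph (?P t) (complete_graph 1)"
  have Q: "finite_simple_graph (?Q t)" for t
    by (intro finite_simple_graph_disjoint_union finite_simple_graph_path_copies
        finite_simple_graph_complete)
  show ?thesis
  proof (cases "odd ?n")
    case True
    then obtain F where F: "spanning_subgraph F G" "graph_isomorphic F (?P ((?n - 3) div 2))"
      using assms unfolding faithful_def Let_def by auto
    then obtain g where g: "carries_onto g (?P ((?n - 3) div 2)) F"
      using carries_onto_if_graph_isomorphic[OF finite_simple_graph_path_copies]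
      unfolding spanning_subgraph_def by blast
    note * = one_nearly_edge_independent_if_carries_onto[OF finite_simple_graph_path_copies
        card_adjacent_pairs_path_copies F(1) g]
    \<comment> \<open>With \<open>t\<close> copies of the complete graph on two vertices, the
      bijection forces \<open>?n = 3 + 2 * t\<close>, which excludes a truncated difference, and
      there are \<open>2 + t\<close> edges.\<close>
    have "card (edges F) = (?n + 1) div 2"
      using *(2,3) unfolding card_verts_path_copies card_edges_path_copies by linarith
    then show ?thesis using *(1) by blast
  next
    case False
    then obtain F where F: "spanning_subgraph F G" "graph_isomorphic F (?Q ((?n - 4) div 2))"
      using assms unfolding faithful_def Let_def by auto
    then obtain g where g: "carries_onto g (?Q ((?n - 4) div 2)) F"
      using carries_onto_if_graph_isomorphic[OF Q]
      unfolding spanning_subgraph_def by blast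
    have "adjacent_pairs (edges (complete_graph 1)) = {}"
      by (simp only: edges_complete_graph_1) (simp add: adjacent_pairs_def)
    then have one: "card (adjacent_pairs (edges (?Q t))) = 1" for t
      by (simp only: card_adjacent_pairs_disjoint_union card_adjacent_pairs_path_copies)
    have verts: "card (verts (?Q t)) = 4 + 2 * t" for t
    proof -
      have "finite (verts (?P t))"
        using finite_simple_graph_path_copies unfolding finite_simple_graph_def by blast
      \<comment> \<open>Only the outer union is unfolded, so \<open>?P t\<close> stays intact on
        both sides.\<close>
      then have "card (verts (?Q t)) = card (verts (?P t)) + 1"
        by (subst disjoint_union_graph_def) (simp add: card_Plus complete_graph_def)
      then show ?thesis by (simp add: card_verts_path_copies)
    qed
    have edges: "card (edges (?Q t)) = 2 + t" for t
    proof -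
      have "{} \<notin> edges (?P t)"
        using finite_simple_graphD(2)[OF finite_simple_graph_path_copies, of "{}" t] by auto
      then show ?thesis
        using finite_edges[OF finite_simple_graph_path_copies, of t]
          card_edges_disjoint_union[of "?P t" "complete_graph 1"] card_edges_path_copies[of t]
        unfolding edges_complete_graph_1 by simp
    qed
    note * = one_nearly_edge_independent_if_carries_onto[OF Q one F(1) g]
    \<comment> \<open>Here \<open>?n = 4 + 2 * t\<close> with \<open>2 + t\<close> edges; the
      rounding in \<open>div\<close> absorbs the isolated vertex.\<close>
    have "card (edges F) = (?n + 1) div 2"
      using *(2,3) unfolding verts edges by linarith
    then show ?thesis using *(1) by blast
  qed
qed

section \<open>Structure of 1-nearly edge independent sets and the upper bound\<close>

text \<open>The unique adjacent pair forms the path, and any further meeting of edges would give a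
  second pair. The path covers 3 vertices with 2 edges and \<open>N\<close> covers 2 vertices per
  edge; the last equation records this count without subtraction.\<close>

lemma one_nearly_edge_independentE:
  assumes G: "finite_simple_graph G" and M: "one_nearly_edge_independent G M"
  obtains a b c N where "M = {{a, b}, {b, c}} \<union> N" "distinct [a, b, c]"
    "N \<subseteq> edges G" "{a, b, c} \<inter> \<Union>N = {}"
    "\<And>e f. e \<in> N \<Longrightarrow> f \<in> N \<Longrightarrow> e \<noteq> f \<Longrightarrow> e \<inter> f = {}"
    "card M = 2 + card N" "card (\<Union>M) + 1 = 2 * card M"
proof -
  have sub: "M \<subseteq> edges G" and "card (adjacent_pairs M) = 1"
    using M by (auto simp: one_nearly_edge_independent_def)
  then obtain P where P: "adjacent_pairs M = {P}" by (auto simp: card_1_singleton_iff)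
  then have "P \<in> adjacent_pairs M" by simp
  then obtain e f where ef: "e \<in> M" "f \<in> M" "e \<noteq> f" "e \<inter> f \<noteq> {}" "P = {e, f}"
    unfolding adjacent_pairs_def by blast
  \<comment> \<open>This is the source of all disjointness below: two distinct edges of
    \<open>M\<close> that meet must be \<open>e\<close> and \<open>f\<close>.\<close>
  have uniq: "{x, y} = {e, f}" if "x \<in> M" "y \<in> M" "x \<noteq> y" "x \<inter> y \<noteq> {}" for x y
    using adjacent_pairsI[OF that] P ef by simp
  obtain b where b: "b \<in> e" "b \<in> f" using ef by blast
  obtain a where a: "e = {a, b}" "a \<noteq> b"
    using finite_simple_graphD(4)[OF G, of e] ef sub b by blast
  obtain c where c: "f = {b, c}" "b \<noteq> c"
    using finite_simple_graphD(4)[OF G, of f] ef sub b by blast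
  \<comment> \<open>\<open>a\<close> and \<open>c\<close> differ because \<open>e\<close> and
    \<open>f\<close> are distinct edges through \<open>b\<close>.\<close>
  have dist: "distinct [a, b, c]" using a c ef by auto
  define N where "N = M - {e, f}"
  have MN: "M = {{a, b}, {b, c}} \<union> N" using ef a c by (auto simp: N_def)
  have NG: "N \<subseteq> edges G" using sub by (auto simp: N_def)
  have avoid: "{a, b, c} \<inter> \<Union>N = {}"
  proof -
    have "e \<inter> x = {} \<and> f \<inter> x = {}" if "x \<in> N" for x
      using uniq[of e x] uniq[of f x] that ef by (auto simp: N_def doubleton_eq_iff)
    then show ?thesis using a c by fast
  qed
  have dis: "x \<inter> y = {}" if "x \<in> N" "y \<in> N" "x \<noteq> y" for x y
    using uniq[of x y] that by (auto simp: N_def doubleton_eq_iff)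
  have finN: "finite N" using finite_subset[OF NG finite_edges[OF G]] .
  have cM: "card M = 2 + card N"
  proof -
    have "{e, f} \<inter> N = {}" "M = {e, f} \<union> N" using ef by (auto simp: N_def)
    then show ?thesis using ef(3) finN by (simp add: card_Un_disjoint)
  qed
  have "card (\<Union>N) = (\<Sum>x\<in>N. card x)"
    using dis NG finite_simple_graphD(3)[OF G]
    by (intro card_Union_disjoint) (auto simp: pairwise_def disjnt_def)
  also have "\<dots> = 2 * card N"
    using NG finite_simple_graphD(2)[OF G] by (simp add: subset_iff)
  finally have cN: "card (\<Union>N) = 2 * card N" .
  have "finite (\<Union>N)" using finN NG finite_simple_graphD(3)[OF G] by blast
  then have "card ({a, b, c} \<union> \<Union>N) = 3 + 2 * card N"
    using avoid dist cN by (subst card_Un_disjoint) auto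
  moreover have "\<Union>M = {a, b, c} \<union> \<Union>N" using MN by auto
  ultimately have "card (\<Union>M) + 1 = 2 * card M" using cM by simp
  then show thesis using that MN dist NG avoid dis cM by blast
qed

lemma card_one_nearly_edge_independent_le:
  assumes G: "finite_simple_graph G" and M: "one_nearly_edge_independent G M"
  shows "2 * card M \<le> card (verts G) + 1"
proof -
  have "\<Union>M \<subseteq> verts G"
    using M finite_simple_graphD(1)[OF G] unfolding one_nearly_edge_independent_def by blast
  then have "card (\<Union>M) \<le> card (verts G)"
    using G unfolding finite_simple_graph_def by (simp add: card_mono)
  then show ?thesis using one_nearly_edge_independentE[OF G M] by (metis add_le_cancel_right)
qed

text \<open>At this size \<open>M\<close> leaves no vertex uncovered when the order is odd and
  exactly one when it is even, which is the isolated vertex of the forest.\<close>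

lemma faithful_if_one_nearly_edge_independent:
  assumes G: "finite_simple_graph G" and M: "one_nearly_edge_independent G M"
    and card_M: "card M = (card (verts G) + 1) div 2"
  shows "faithful G"
proof -
  obtain a b c N where MN: "M = {{a, b}, {b, c}} \<union> N" and dist: "distinct [a, b, c]"
    and NG: "N \<subseteq> edges G" and avoid: "{a, b, c} \<inter> \<Union>N = {}"
    and dis: "\<And>e f. e \<in> N \<Longrightarrow> f \<in> N \<Longrightarrow> e \<noteq> f \<Longrightarrow> e \<inter> f = {}"
    and cM: "card M = 2 + card N" and cU: "card (\<Union>M) + 1 = 2 * card M"
    using one_nearly_edge_independentE[OF G M] by blast
  let ?P = "disjoint_union_graph (path_graph 3) (copies_graph (card N) (complete_graph 2))"
  have finV: "finite (verts G)" using G by (simp add: finite_simple_graph_def)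
  have MG: "M \<subseteq> edges G" using M by (simp add: one_nearly_edge_independent_def)
  have UV: "\<Union>M \<subseteq> verts G" using MG finite_simple_graphD(1)[OF G] by blast
  \<comment> \<open>The forest keeps all vertices of \<open>G\<close>, so vertices that
    \<open>M\<close> misses become isolated.\<close>
  have span: "spanning_subgraph \<lparr>verts = verts G, edges = M\<rparr> G"
    using G MG by (auto simp: spanning_subgraph_def finite_simple_graph_def)
  obtain p where p: "carries_onto p (path_graph 3)
      \<lparr>verts = {a, b, c}, edges = {{a, b}, {b, c}}\<rparr>"
    using carries_onto_path_graph_3[OF dist] by blast
  obtain q where q: "carries_onto q (copies_graph (card N) (complete_graph 2))
      \<lparr>verts = \<Union>N, edges = N\<rparr>"
    using carries_onto_matching[of N] finite_subset[OF NG finite_edges[OF G]]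
      finite_simple_graphD(2)[OF G] NG dis by blast
  have "{a, b, c} \<union> \<Union>N = \<Union>M" using MN by auto
  then obtain r where r: "carries_onto r ?P \<lparr>verts = \<Union>M, edges = M\<rparr>"
    using carries_onto_disjoint_union[OF p q avoid] MN by auto
  show ?thesis
  proof (cases "odd (card (verts G))")
    case True
    \<comment> \<open>For odd order, \<open>2 * card M\<close> is the order plus 1.\<close>
    then have "card (\<Union>M) = card (verts G)" using cU card_M by presburger
    then have "\<Union>M = verts G" using card_subset_eq[OF finV UV] by blast
    then have "graph_isomorphic \<lparr>verts = verts G, edges = M\<rparr> ?P"
      using graph_isomorphic_if_carries_onto[OF finite_simple_graph_path_copies r] by simp
    moreover have "(card (verts G) - 3) div 2 = card N" using True card_M cM by presburger
    ultimately show ?thesis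
      unfolding faithful_def Let_def using span True by auto
  next
    case False
    \<comment> \<open>For even order, \<open>2 * card M\<close> is the order itself.\<close>
    then have "card (verts G) = card (\<Union>M) + 1" using cU card_M by presburger
    then have "card (verts G - \<Union>M) = 1"
      using card_Diff_subset[OF finite_subset[OF UV finV] UV] by simp
    then obtain v where v: "verts G - \<Union>M = {v}" by (auto simp: card_1_singleton_iff)
    then have "\<Union>M \<inter> {v} = {}" "\<Union>M \<union> {v} = verts G" using UV by auto
    then have "carries_onto (case_sum r (\<lambda>_. v)) (disjoint_union_graph ?P (complete_graph 1))
        \<lparr>verts = verts G, edges = M\<rparr>"
      using carries_onto_disjoint_union[OF r carries_onto_complete_graph_1, of v] by simp
    then have "graph_isomorphic \<lparr>verts = verts G, edges = M\<rparr>
        (disjoint_union_graph ?P (complete_graph 1))"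
      by (intro graph_isomorphic_if_carries_onto finite_simple_graph_disjoint_union
          finite_simple_graph_path_copies finite_simple_graph_complete)
    moreover have "(card (verts G) - 4) div 2 = card N" using False card_M cM by presburger
    ultimately show ?thesis
      unfolding faithful_def Let_def using span False by auto
  qed
qed

section \<open>The bound and its equality case for the maximum\<close>

theorem theorem3p2:
  fixes G :: "'a graph" and n :: nat
  assumes "finite_simple_graph G"
    and "card (verts G) = n"
    and "n \<ge> 1"
  shows "one_nearly_edge_independence_number G \<le> (n + 1) div 2 \<and>
    (one_nearly_edge_independence_number G = (n + 1) div 2 \<longleftrightarrow> faithful G)"
proof -
  let ?S = "{M. one_nearly_edge_independent G M}"
  let ?k = "one_nearly_edge_independence_number G"
  have "?S \<subseteq> Pow (edges G)" by (auto simp: one_nearly_edge_independent_def)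
  then have fin: "finite (card ` ?S)"
    using finite_edges[OF assms(1)] by (meson finite_Pow_iff finite_imageI finite_subset)
  \<comment> \<open>A nonzero value cannot be the default 0, so it is a maximum over a nonempty
    finite set.\<close>
  have attained: "\<exists>M. one_nearly_edge_independent G M \<and> card M = ?k" if "?k \<noteq> 0"
  proof -
    have "?k = Max (card ` ?S)" "card ` ?S \<noteq> {}"
      using that by (auto simp: one_nearly_edge_independence_number_def split: if_splits)
    then have "?k \<in> card ` ?S" using Max_in[OF fin] by simp
    then show ?thesis by auto
  qed
  have le: "?k \<le> (n + 1) div 2"
  proof (cases "?k = 0")
    case False
    then show ?thesis
      using attained card_one_nearly_edge_independent_le[OF assms(1)] assms(2) by fastforce
  qed simp
  \<comment> \<open>As \<open>n \<ge> 1\<close>, the value \<open>(n + 1) div 2\<close> is positive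
    and hence attained. For \<open>n = 0\<close> the default 0 would give equality although the
    empty graph is not faithful.\<close>
  moreover have "faithful G" if "?k = (n + 1) div 2"
    using attained that assms(2,3) faithful_if_one_nearly_edge_independent[OF assms(1)] by fastforce
  moreover have "?k = (n + 1) div 2" if "faithful G"
  proof -
    obtain M where M: "one_nearly_edge_independent G M" "card M = (n + 1) div 2"
      using one_nearly_edge_independent_if_faithful[OF \<open>faithful G\<close>] assms(2) by auto
    then have "card M \<le> Max (card ` ?S)" by (intro Max_ge[OF fin]) blast
    then have "card M \<le> ?k"
      using M(1) unfolding one_nearly_edge_independence_number_def by auto
    then show ?thesis using le M(2) by simp
  qed
  ultimately show ?thesis by blast
qed

end
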